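(* Let $f_1,\dots,f_n:2^V\to\mathbb{R}_{\ge 0}$ be monotone nondecreasing functions (not necessarily submodular) with $f_i(\emptyset)=0$ for all $i$, let $\gamma_i$ be the submodularity ratio of $f_i$, suppose $\gamma_i>0$ for all $i$, and let $\gamma_c=\min_{i\in\mathcal{N}}\gamma_i$. Let $f=\frac1n\sum_{i=1}^n f_i$, let $K$ be an integer with $1\le K\le |V|$, let $\mathcal{G}=(\mathcal{N},\mathcal{E})$ be a connected undirected graph on $\mathcal{N}=\{1,\dots,n\}$, and let $W\in\mathbb{R}^{n\times n}$ be an admissible weight matrix for $\mathcal{G}$. Let $T\in\mathbb{Z}_{\ge 1}$, $T'=T+1+d(\mathcal{G})$, let $F_h=\max_{i\in\mathcal{N}}f_i(V)$, $\epsilon(T)=\sqrt{n}\,(\mu(W))^T F_h$, and let $\psi\in\mathbb{R}_{\ge 0}$ satisfy $\psi\ge 4\sqrt{n}\,(\mu(W))^T F_h$. Then the Distributed Greedy Algorithm (described in the context), run with these data, lets all agents reach consensus at a solution, i.e. $\bar S_i^K=\bar S_j^K=:\bar S^K$ for all $i,j\in\mathcal{N}$, with $|\bar S^K|\le K$, and $$f(\bar S^K)\ \ge\ \big(1-e^{-\gamma_c}\big) f(S^* )-K\big(\psi+2\epsilon(T)\big),$$ where $S^*$ is an optimal solution to $\max_{S\subseteq V,\ |S|\le K} f(S)$.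
   Context: Setting. $V=\{v_1,\dots,v_{|V|}\}$ is a finite ground set whose labelling is common to all agents. A set function $g:2^V\to\mathbb{R}_{\ge0}$ is monotone nondecreasing if $g(A)\le g(B)$ for all $A\subseteq B\subseteq V$. The submodularity ratio of a monotone nondecreasing $g:2^V\to\mathbb{R}_{\ge0}$ is the largest $\gamma\in[0,1]$ such that $\sum_{a\in A\setminus B}\big(g(\{a\}\cup B)-g(B)\big)\ge\gamma\big(g(A\cup B)-g(B)\big)$ for all $A,B\subseteq V$. There are $n\ge2$ agents $\mathcal{N}=\{1,\dots,n\}$; $\mathcal{N}_i=\{j\in\mathcal{N}:(i,j)\in\mathcal{E}\}$ is the set of neighbours of $i$ (not including $i$); $d(\mathcal{G})=\max_{i,j\in\mathcal{N}}l_{ij}$ is the diameter of $\mathcal{G}$, where $l_{ij}$ is the length of a shortest path from $i$ to $j$. Admissible weight matrix. $W=(w_{ij})\in\mathbb{R}^{n\times n}$ is admissible for $\mathcal{G}$ if: (1) $w_{ij}\ge0$ for all $i,j$, and $w_{ij}=0$ whenever $i\ne j$ and $(i,j)\notin\mathcal{E}$; (2) $W\mathbf{1}_n=\mathbf{1}_n$, where $\mathbf{1}_n$ is the all-ones vector; (3) $W$ is symmetric; (4) $\mu(W):=\max\{\lambda_2(W),-\lambda_n(W)\}<1$, where $1=\lambda_1(W)\ge\lambda_2(W)\ge\cdots\ge\lambda_n(W)\ge-1$ are the eigenvalues of $W$. Distributed Greedy Algorithm. All agents share a synchronized clock and know $T$, $T'$, $\psi$ and $K$; agent $i$ knows $f_i$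 and the $i$th row of $W$. Initially $\bar S_i^0=\emptyset$ for every agent $i$. For $k=0,1,\dots,K-1$ each agent $i$ performs the following round (the round starts with all agents holding the same set $\bar S_i^k$; that this is preserved from round to round is part of the consensus property of the algorithm), with $V_k=V\setminus\bar S_i^k$: (i) set $x_{i,v}^0=f_i(\{v\}\cup\bar S_i^k)-f_i(\bar S_i^k)$ for $v\in V_k$; (ii) for $t=0,\dots,T-1$ and all $v\in V_k$, set $x_{i,v}^{t+1}=w_{ii}x_{i,v}^t+\sum_{j\in\mathcal{N}_i}w_{ij}x_{j,v}^t$; (iii) set $S_i^{T+1}=\{v\in V_k: x_{i,v}^T\ge \max_{u\in V_k}x_{i,u}^T-\psi\}$; (iv) for $t=T+1,\dots,T'-1$, set $S_i^{t+1}=\bigcap_{j\in\mathcal{N}_i\cup\{i\}}S_j^t$; (v) let $j_{\min}=\min\{j: v_j\in S_i^{T'}\}$ and set $\bar S_i^{k+1}=\{v_{j_{\min}}\}\cup\bar S_i^k$. The output of agent $i$ is $\bar S_i^K$. *)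

theory Defs
  imports
    "HOL-Computational_Algebra.Polynomial"
    "Jordan_Normal_Form.Char_Poly"
    "Graph_Theory.Graph_Theory"
begin

section \<open>Set functions\<close>

definition submodularity_ratio :: "'a set \<Rightarrow> ('a set \<Rightarrow> real) \<Rightarrow> real" where
  "submodularity_ratio V g = (GREATEST \<gamma>. 0 \<le> \<gamma> \<and> \<gamma> \<le> 1 \<and>
     (\<forall>A\<subseteq>V. \<forall>B\<subseteq>V. (\<Sum>a\<in>A - B. g ({a} \<union> B) - g B) \<ge> \<gamma> * (g (A \<union> B) - g B)))"


section \<open>Communication graph and weight matrix\<close>

text \<open>
  The $n$ agents are the numbers below \<open>n\<close>, so that they index the rows and columns of an
  $n \times n$ matrix directly.
  An undirected graph is a symmetric loop-free digraph (\<^const>\<open>pair_graph\<close>).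
\<close>

definition neighbours :: "nat pair_pre_digraph \<Rightarrow> nat \<Rightarrow> nat set" where
  "neighbours G i = {j \<in> pverts G. (i, j) \<in> parcs G}"

definition graph_dist :: "nat pair_pre_digraph \<Rightarrow> nat \<Rightarrow> nat \<Rightarrow> nat" where
  "graph_dist G i j = (LEAST l. \<exists>p. pre_digraph.apath (with_proj G) i p j \<and> length p = l)"

definition graph_diameter :: "nat pair_pre_digraph \<Rightarrow> nat" where
  "graph_diameter G = Max {graph_dist G i j | i j. i \<in> pverts G \<and> j \<in> pverts G}"

text \<open>
  The real eigenvalues in descending order, repeated according to algebraic multiplicity and
  counted from $k = 1$. A real symmetric $n \times n$ matrix has exactly $n$ of them;
  for other matrices the list may be shorter.
\<close>

definition eigval_desc :: "real mat \<Rightarrow> nat \<Rightarrow> real" where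
  "eigval_desc W k = rev (sorted_list_of_multiset (proots (char_poly W))) ! (k - 1)"

definition mu :: "real mat \<Rightarrow> real" where
  "mu W = max (eigval_desc W 2) (- eigval_desc W (dim_row W))"

definition admissible_weights :: "nat \<Rightarrow> nat pair_pre_digraph \<Rightarrow> real mat \<Rightarrow> bool" where
  "admissible_weights n G W \<longleftrightarrow>
     W \<in> carrier_mat n n \<and>
     (\<forall>i<n. \<forall>j<n. W $$ (i, j) \<ge> 0) \<and>
     (\<forall>i<n. \<forall>j<n. i \<noteq> j \<and> (i, j) \<notin> parcs G \<longrightarrow> W $$ (i, j) = 0) \<and>
     W *\<^sub>v vec n (\<lambda>_. 1) = vec n (\<lambda>_. 1) \<and>
     transpose_mat W = W \<and>
     mu W < 1"


section \<open>Distributed greedy algorithm\<close>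

text \<open>
  A state \<open>S\<close> assigns to every agent \<open>i\<close> the set \<open>S i\<close> it currently holds. Each agent works
  with its own set; that these sets agree at the start of a round is not built in.
\<close>

definition local_gain :: "(nat \<Rightarrow> 'a set \<Rightarrow> real) \<Rightarrow> (nat \<Rightarrow> 'a set) \<Rightarrow> nat \<Rightarrow> 'a \<Rightarrow> real" where
  "local_gain f S i v = f i ({v} \<union> S i) - f i (S i)"

primrec mix :: "nat pair_pre_digraph \<Rightarrow> real mat \<Rightarrow> (nat \<Rightarrow> 'a \<Rightarrow> real) \<Rightarrow> nat
    \<Rightarrow> nat \<Rightarrow> 'a \<Rightarrow> real" where
  "mix G W x 0 i v = x i v"
| "mix G W x (Suc t) i v =
     W $$ (i, i) * mix G W x t i v + (\<Sum>j\<in>neighbours G i. W $$ (i, j) * mix G W x t j v)"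

definition candidates :: "'a set \<Rightarrow> real \<Rightarrow> (nat \<Rightarrow> 'a set) \<Rightarrow> (nat \<Rightarrow> 'a \<Rightarrow> real)
    \<Rightarrow> nat \<Rightarrow> 'a set" where
  "candidates V \<psi> S x i = {v \<in> V - S i. x i v \<ge> Max ((\<lambda>u. x i u) ` (V - S i)) - \<psi>}"

primrec intersect_steps :: "nat pair_pre_digraph \<Rightarrow> (nat \<Rightarrow> 'a set) \<Rightarrow> nat \<Rightarrow> nat \<Rightarrow> 'a set" where
  "intersect_steps G C 0 i = C i"
| "intersect_steps G C (Suc s) i = (\<Inter>j\<in>neighbours G i \<union> {i}. intersect_steps G C s j)"

text \<open>
  \<open>lab j\<close> is the ground element $v_j$, for $1 \le j \le |V|$. Candidate sets are formed at
  time $T + 1$ and intersected at times $T + 1, \dots, T' - 1$.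
\<close>

definition dga_round :: "'a set \<Rightarrow> (nat \<Rightarrow> 'a) \<Rightarrow> (nat \<Rightarrow> 'a set \<Rightarrow> real)
    \<Rightarrow> nat pair_pre_digraph \<Rightarrow> real mat \<Rightarrow> nat \<Rightarrow> nat \<Rightarrow> real
    \<Rightarrow> (nat \<Rightarrow> 'a set) \<Rightarrow> nat \<Rightarrow> 'a set" where
  "dga_round V lab f G W T T' \<psi> S i =
     (let x = mix G W (local_gain f S) T;
          C = intersect_steps G (candidates V \<psi> S x) (T' - (T + 1)) i;
          jmin = Min {j \<in> {1..card V}. lab j \<in> C}
      in {lab jmin} \<union> S i)"

primrec dga :: "'a set \<Rightarrow> (nat \<Rightarrow> 'a) \<Rightarrow> (nat \<Rightarrow> 'a set \<Rightarrow> real)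
    \<Rightarrow> nat pair_pre_digraph \<Rightarrow> real mat \<Rightarrow> nat \<Rightarrow> nat \<Rightarrow> real
    \<Rightarrow> nat \<Rightarrow> nat \<Rightarrow> 'a set" where
  "dga V lab f G W T T' \<psi> 0 = (\<lambda>i. {})"
| "dga V lab f G W T T' \<psi> (Suc k) = dga_round V lab f G W T T' \<psi> (dga V lab f G W T T' \<psi> k)"

end

theory Submission
  imports Defs
begin

text \<open>
  The algorithm is the greedy algorithm for the average \<open>favg\<close>, run with inexact marginal gains.
  Three facts combine.

  Averaging: a symmetric weight matrix acts diagonally in an orthonormal basis
  (\<open>symmetric_orthogonal_diagonalization\<close>). The consensus direction is the eigenvector for the
  simple eigenvalue 1, and all other eigenvalues have modulus at most $\mu(W)$. Hence the deviation
  from the mean shrinks by $\mu(W)$ per step, and after $T$ steps every agent knows every average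
  marginal gain up to $\epsilon(T)$ (\<open>contraction_on_mean_zero_vectors\<close>, \<open>mix_error\<close>).

  Agreement: since $\psi \ge 2\epsilon(T)$, the element with the best average gain lies in every
  candidate set. Within as many steps as the diameter, repeated intersection gives all agents the
  same nonempty set (\<open>intersect_steps_diameter\<close>), from which the common labelling selects the same
  element. Its average gain is within $\delta = \psi + 2\epsilon(T)$ of the best possible one
  (\<open>dga_round_adds_common_approximate_maximizer\<close>).

  Greedy bound: the average satisfies the submodularity-ratio inequality with the smallest of the
  ratios, $\gamma_c$ (\<open>weakly_submodular_mean\<close>), so each round multiplies the gap to the optimum by
  $1 - \gamma_c / K$ and adds at most $\delta$ (\<open>approximate_greedy_step\<close>). After $K$ rounds the
  gap is at most $(1 - \gamma_c / K)^K \le e^{-\gamma_c}$ times the optimum, plus $K \delta$.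
\<close>

section \<open>Orthogonal diagonalization of real symmetric matrices\<close>

text \<open>
  Reflecting in the hyperplane orthogonal to $u = v - e_0$ swaps the unit vectors $v$ and $e_0$.
  In the diagonalization below, such a reflection moves an eigenvector to the first coordinate axis;
  being its own transpose and its own inverse, it preserves both the spectrum and symmetry.
\<close>

lemma householder_reflection:
  fixes v :: "real vec"
  assumes v: "v \<in> carrier_vec n" and n: "0 < n" and norm_v: "v \<bullet> v = 1"
  obtains H where "H \<in> carrier_mat n n" "transpose_mat H = H" "H * H = 1\<^sub>m n"
    "H *\<^sub>v v = unit_vec n 0"
proof (cases "v = unit_vec n 0")
  case True
  then show ?thesis
    by (intro that[of "1\<^sub>m n"]) auto
next
  case False
  define u where "u = v - unit_vec n 0"
  define c where "c = 2 / (u \<bullet> u)"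
  define H where "H = mat n n (\<lambda>(i, j). (if i = j then 1 else 0) - c * u $ i * u $ j)"
  have u: "u \<in> carrier_vec n" and u_index: "\<And>i. i < n \<Longrightarrow> u $ i = v $ i - (if i = 0 then 1 else 0)"
    using v by (auto simp: u_def unit_vec_def)
  have "u \<noteq> 0\<^sub>v n"
  proof
    assume "u = 0\<^sub>v n"
    then have "v = unit_vec n 0"
      using v u_index by (intro eq_vecI) (auto simp: unit_vec_def)
    with False show False ..
  qed
  then have uu: "u \<bullet> u \<noteq> 0"
    using conjugate_square_eq_0_vec[OF u] by simp
  have uv: "u \<bullet> v = 1 - v $ 0"
  proof -
    have "u \<bullet> v = v \<bullet> v - unit_vec n 0 \<bullet> v"
      unfolding u_def using v by (intro minus_scalar_prod_distrib) auto
    then show ?thesis using norm_v v n by simp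
  qed
  have "u \<bullet> u = u \<bullet> v - u \<bullet> unit_vec n 0"
    using v u by (subst (2) u_def, intro scalar_prod_minus_distrib) auto
  also have "u \<bullet> unit_vec n 0 = v $ 0 - 1"
    using u n u_index by simp
  finally have uu_eq: "u \<bullet> u = 2 * (1 - v $ 0)"
    using uv by simp
  have sum_uu: "(\<Sum>k = 0..<n. u $ k * u $ k) = u \<bullet> u"
    using u by (simp add: scalar_prod_def)
  have H: "H \<in> carrier_mat n n" by (simp add: H_def)
  show ?thesis
  proof (rule that[OF H])
    show "transpose_mat H = H"
      by (rule eq_matI) (auto simp: H_def)
    show "H * H = 1\<^sub>m n"
    proof (rule eq_matI)
      fix i j assume ij: "i < dim_row (1\<^sub>m n)" "j < dim_col (1\<^sub>m n)"
      have "(H * H) $$ (i, j) = (\<Sum>k = 0..<n. H $$ (i, k) * H $$ (k, j))"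
        using ij H by (simp add: scalar_prod_def)
      also have "\<dots> = (\<Sum>k = 0..<n. (if k = i then (if i = j then 1 else 0) else 0)
          - (if k = i then c * u $ k * u $ j else 0) - (if k = j then c * u $ i * u $ k else 0)
          + c * c * u $ i * u $ j * (u $ k * u $ k))"
        using ij by (intro sum.cong) (auto simp: H_def algebra_simps)
      also have "\<dots> = (if i = j then 1 else 0) - c * u $ i * u $ j - c * u $ i * u $ j
          + c * c * u $ i * u $ j * (u \<bullet> u)"
        using ij by (simp add: sum.distrib sum_subtractf sum_uu flip: sum_distrib_left)
      also have "\<dots> = (if i = j then 1 else 0)"
        using uu by (simp add: c_def)
      finally show "(H * H) $$ (i, j) = 1\<^sub>m n $$ (i, j)"
        using ij by simp
    qed (use H in auto)
    show "H *\<^sub>v v = unit_vec n 0"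
    proof (rule eq_vecI)
      fix i assume i: "i < dim_vec (unit_vec n 0 :: real vec)"
      have "(H *\<^sub>v v) $ i = (\<Sum>k = 0..<n. H $$ (i, k) * v $ k)"
        using i H v by (simp add: scalar_prod_def)
      also have "\<dots> = (\<Sum>k = 0..<n. (if k = i then v $ k else 0) - c * u $ i * (u $ k * v $ k))"
        using i by (intro sum.cong) (auto simp: H_def algebra_simps)
      also have "\<dots> = v $ i - c * u $ i * (u \<bullet> v)"
        using i v by (simp add: sum_subtractf scalar_prod_def flip: sum_distrib_left)
      also have "c * (u \<bullet> v) = 1"
        using uu unfolding c_def uu_eq uv by simp
      then have "c * u $ i * (u \<bullet> v) = u $ i"
        by (simp add: mult.assoc mult.left_commute)
      finally show "(H *\<^sub>v v) $ i = unit_vec n 0 $ i"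
        using i u_index by (auto simp: unit_vec_def)
    qed (use H in auto)
  qed
qed

text \<open>
  Symmetry lets $A$ move across the Hermitian form, so for an eigenvector $v$ both $a$ and its
  conjugate multiply the nonzero number $N = \sum_i v_i \overline{v_i}$ to the same value.
\<close>

lemma symmetric_real_eigenvalue:
  fixes A :: "real mat"
  assumes A: "A \<in> carrier_mat n n" and sym: "transpose_mat A = A"
    and ev: "eigenvalue (map_mat complex_of_real A) a"
  shows "a \<in> \<real>"
proof -
  let ?A = "map_mat complex_of_real A"
  have A_sym: "A $$ (i, j) = A $$ (j, i)" if "i < n" "j < n" for i j
    using arg_cong[OF sym, of "\<lambda>B. B $$ (i, j)"] that A by simp
  obtain v where v: "v \<in> carrier_vec n" and v0: "v \<noteq> 0\<^sub>v n" and Av: "?A *\<^sub>v v = a \<cdot>\<^sub>v v"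
    using ev A by (auto simp: eigenvalue_def eigenvector_def)
  have Av_i: "(\<Sum>j = 0..<n. complex_of_real (A $$ (i, j)) * v $ j) = a * v $ i" if "i < n" for i
    using arg_cong[OF Av, of "\<lambda>w. w $ i"] that A v by (simp add: scalar_prod_def)
  have cAv_i: "(\<Sum>j = 0..<n. complex_of_real (A $$ (i, j)) * cnj (v $ j)) = cnj a * cnj (v $ i)"
    if "i < n" for i
    using arg_cong[OF Av_i[OF that], of cnj] by simp
  define N where "N = (\<Sum>i = 0..<n. v $ i * cnj (v $ i))"
  have "N = v \<bullet>c v"
    using v by (auto simp: N_def scalar_prod_def)
  then have "N \<noteq> 0"
    using conjugate_square_eq_0_vec[OF v] v0 by simp
  have "a * N = (\<Sum>i = 0..<n. (a * v $ i) * cnj (v $ i))"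
    by (simp add: N_def sum_distrib_left mult.assoc)
  also have "\<dots> = (\<Sum>i = 0..<n. \<Sum>j = 0..<n. complex_of_real (A $$ (i, j)) * v $ j * cnj (v $ i))"
    by (intro sum.cong) (auto simp: Av_i[symmetric] sum_distrib_right)
  also have "\<dots> = (\<Sum>j = 0..<n. \<Sum>i = 0..<n. complex_of_real (A $$ (i, j)) * v $ j * cnj (v $ i))"
    by (rule sum.swap)
  also have "\<dots> = (\<Sum>j = 0..<n. v $ j * (\<Sum>i = 0..<n. complex_of_real (A $$ (j, i)) * cnj (v $ i)))"
    by (intro sum.cong) (auto simp: sum_distrib_left A_sym mult_ac)
  also have "\<dots> = (\<Sum>j = 0..<n. v $ j * (cnj a * cnj (v $ j)))"
    by (intro sum.cong) (auto simp: cAv_i)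
  also have "\<dots> = cnj a * N"
    by (simp add: N_def sum_distrib_left mult_ac)
  finally have "a = cnj a"
    using \<open>N \<noteq> 0\<close> by simp
  then show ?thesis
    by (metis Reals_cnj_iff)
qed

text \<open>
  The complex linear factors exist by the fundamental theorem of algebra; their roots are real,
  and embedding real polynomials into complex ones is injective, so the factorization descends.
\<close>

lemma symmetric_char_poly_splits:
  fixes A :: "real mat"
  assumes A: "A \<in> carrier_mat n n" and sym: "transpose_mat A = A"
  obtains es where "char_poly A = (\<Prod>e\<leftarrow>es. [:- e, 1:])"
proof -
  let ?A = "map_mat complex_of_real A"
  interpret map_poly_inj_comm_ring_hom complex_of_real ..
  have cA: "?A \<in> carrier_mat n n" using A by simp
  obtain as where as: "char_poly ?A = (\<Prod>a\<leftarrow>as. [:- a, 1:])"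
    using char_poly_factorized[OF cA] by auto
  have real: "a \<in> \<real>" if "a \<in> set as" for a
  proof -
    have "poly (char_poly ?A) a = 0"
      using that unfolding as by (induction as) auto
    then show ?thesis
      using symmetric_real_eigenvalue[OF A sym] eigenvalue_root_char_poly[OF cA] by blast
  qed
  have "map_poly complex_of_real (char_poly A) = (\<Prod>a\<leftarrow>as. [:- a, 1:])"
    unfolding as[symmetric] by (rule of_real_hom.char_poly_hom[OF A, symmetric])
  also have "\<dots> = map_poly complex_of_real (\<Prod>e\<leftarrow>map Re as. [:- e, 1:])"
    using real by (induction as) (auto simp: hom_distribs)
  finally have "char_poly A = (\<Prod>e\<leftarrow>map Re as. [:- e, 1:])"
    by (simp only: eq_iff)
  then show ?thesis by (rule that)
qed

text \<open>
  Induction on the eigenvalue list: a reflection turns a unit eigenvector for the first eigenvalue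
  into $e_0$, and by symmetry the reflected matrix then splits into that eigenvalue and a smaller
  symmetric block carrying the remaining eigenvalues. Prescribing the order of the eigenvalues
  makes it possible to address the diagonal by rank in the sorted spectrum later on.
\<close>

theorem symmetric_orthogonal_diagonalization:
  fixes A :: "real mat"
  assumes "A \<in> carrier_mat n n" and "transpose_mat A = A"
    and "char_poly A = (\<Prod>e\<leftarrow>es. [:- e, 1:])"
  shows "\<exists>P \<in> carrier_mat n n. transpose_mat P * P = 1\<^sub>m n \<and>
    transpose_mat P * A * P = mat n n (\<lambda>(i, j). if i = j then es ! i else 0)"
  using assms
proof (induction es arbitrary: n A)
  case Nil
  then have "n = 0"
    using degree_monic_char_poly[OF Nil(1)] by simp
  then show ?case
    by (intro bexI[of _ "1\<^sub>m n"]) auto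
next
  case (Cons e es)
  note A = Cons.prems(1) and sym = Cons.prems(2)
  have cp: "char_poly A = [:- e, 1:] * (\<Prod>e\<leftarrow>es. [:- e, 1:])"
    using Cons.prems(3) by simp
  have "(\<Prod>e\<leftarrow>es. [:- e, 1:]) \<noteq> (0 :: real poly)"
    by (auto simp: prod_list_zero_iff)
  then have "degree (char_poly A) \<noteq> 0"
    unfolding cp by (subst degree_mult_eq) auto
  then obtain m where n: "n = 1 + m"
    using degree_monic_char_poly[OF A] by (cases n) auto
  have "eigenvalue A e"
    unfolding eigenvalue_root_char_poly[OF A] cp by simp
  then obtain w where w: "w \<in> carrier_vec n" and w0: "w \<noteq> 0\<^sub>v n" and Aw: "A *\<^sub>v w = e \<cdot>\<^sub>v w"
    using A by (auto simp: eigenvalue_def eigenvector_def)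
  have ww: "w \<bullet> w > 0"
    using conjugate_square_greater_0_vec[OF w] w0 by simp
  define v where "v = (1 / sqrt (w \<bullet> w)) \<cdot>\<^sub>v w"
  have v: "v \<in> carrier_vec n" using w by (simp add: v_def)
  have "v \<bullet> v = 1"
    using ww w by (simp add: v_def power2_eq_square[symmetric])
  have Av: "A *\<^sub>v v = e \<cdot>\<^sub>v v"
    using A w Aw by (simp add: v_def mult_mat_vec smult_smult_assoc mult.commute)
  obtain H where H: "H \<in> carrier_mat n n" and H_sym: "transpose_mat H = H"
    and HH: "H * H = 1\<^sub>m n" and Hv: "H *\<^sub>v v = unit_vec n 0"
    using householder_reflection[OF v _ \<open>v \<bullet> v = 1\<close>] n by auto
  define A' where "A' = H * A * H"
  have A': "A' \<in> carrier_mat n n" using A H by (simp add: A'_def)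
  have A'_sym: "transpose_mat A' = A'"
    using A H by (simp add: A'_def transpose_mult[of _ n n _ n] sym H_sym assoc_mult_mat[of _ n n _ n _ n])
  have "H *\<^sub>v unit_vec n 0 = v"
    using H v HH by (simp add: Hv[symmetric] assoc_mult_mat_vec[symmetric, of _ n n _ n])
  then have A'_unit: "A' *\<^sub>v unit_vec n 0 = e \<cdot>\<^sub>v unit_vec n 0"
    using A H v by (simp add: A'_def assoc_mult_mat_vec[of _ n n _ n] Av mult_mat_vec[of _ n n] Hv)
  have col0: "A' $$ (i, 0) = (if i = 0 then e else 0)" if "i < n" for i
    using arg_cong[OF A'_unit, of "\<lambda>x. x $ i"] that A' n by auto
  have row0: "A' $$ (0, i) = (if i = 0 then e else 0)" if "i < n" for i
    using arg_cong[OF A'_sym, of "\<lambda>B. B $$ (0, i)"] col0[OF that] A' that n by auto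
  define A3 where "A3 = mat m m (\<lambda>(i, j). A' $$ (Suc i, Suc j))"
  let ?e = "mat 1 1 (\<lambda>_. e)"
  have A3: "A3 \<in> carrier_mat m m" by (simp add: A3_def)
  have A'_block: "A' = four_block_mat ?e (0\<^sub>m 1 m) (0\<^sub>m m 1) A3"
    using A' n row0 col0 by (intro eq_matI) (auto simp: A3_def)
  have A3_sym: "transpose_mat A3 = A3"
  proof (rule eq_matI)
    fix i j assume "i < dim_row A3" "j < dim_col A3"
    then show "transpose_mat A3 $$ (i, j) = A3 $$ (i, j)"
      using arg_cong[OF A'_sym, of "\<lambda>B. B $$ (Suc i, Suc j)"] A' n by (simp add: A3_def)
  qed (use A3 in auto)
  have "similar_mat A' A"
    unfolding similar_mat_def
    by (intro exI, rule similar_mat_witI[of H H n]) (use A H A' HH in \<open>auto simp: A'_def\<close>)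
  then have "char_poly A' = [:- e, 1:] * (\<Prod>e\<leftarrow>es. [:- e, 1:])"
    using cp char_poly_similar by metis
  moreover have "char_poly A' = char_poly ?e * char_poly A3"
    unfolding A'_block by (rule char_poly_four_block_zeros_col) (use A3 in auto)
  moreover have "char_poly ?e = [:- e, 1:]"
    by (simp add: char_poly_defs det_def sign_def)
  ultimately have "char_poly A3 = (\<Prod>e\<leftarrow>es. [:- e, 1:])"
    by (metis mult_cancel_left pCons_eq_0_iff zero_neq_one)
  from Cons.IH[OF A3 A3_sym this] obtain Q where Q: "Q \<in> carrier_mat m m"
    and QQ: "transpose_mat Q * Q = 1\<^sub>m m"
    and QAQ: "transpose_mat Q * A3 * Q = mat m m (\<lambda>(i, j). if i = j then es ! i else 0)"
    by auto
  define R where "R = four_block_mat (1\<^sub>m 1) (0\<^sub>m 1 m) (0\<^sub>m m 1) Q"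
  have R: "R \<in> carrier_mat n n" and RT: "transpose_mat R \<in> carrier_mat n n"
    unfolding R_def n transpose_carrier_mat using Q by (intro four_block_carrier_mat; simp)+
  have R_transpose: "transpose_mat R = four_block_mat (1\<^sub>m 1) (0\<^sub>m 1 m) (0\<^sub>m m 1) (transpose_mat Q)"
    unfolding R_def using Q by (subst transpose_four_block_mat[of _ 1 1 _ m _ m]) auto
  have RR: "transpose_mat R * R = 1\<^sub>m n"
    unfolding R_transpose unfolding R_def n
    using Q QQ by (subst mult_four_block_mat[of _ 1 1 _ m _ m _ _ 1 _ m]) auto
  have "transpose_mat R * A' * R = four_block_mat ?e (0\<^sub>m 1 m) (0\<^sub>m m 1) (transpose_mat Q * A3 * Q)"
    unfolding R_transpose A'_block unfolding R_def using Q A3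
    by (simp add: mult_four_block_mat[of _ 1 1 _ m _ m _ _ 1 _ m])
  also have "\<dots> = mat n n (\<lambda>(i, j). if i = j then (e # es) ! i else 0)"
    unfolding QAQ n by (rule eq_matI) auto
  finally have RA'R: "transpose_mat R * A' * R = mat n n (\<lambda>(i, j). if i = j then (e # es) ! i else 0)" .
  have P_transpose: "transpose_mat (H * R) = transpose_mat R * H"
    using H R by (simp add: transpose_mult[of _ n n _ n] H_sym)
  show ?case
  proof (intro bexI[of _ "H * R"] conjI)
    show "H * R \<in> carrier_mat n n" using H R by simp
    have "transpose_mat (H * R) * (H * R) = transpose_mat R * ((H * H) * R)"
      unfolding P_transpose using H R RT by (simp add: assoc_mult_mat[of _ n n _ n _ n])
    then show "transpose_mat (H * R) * (H * R) = 1\<^sub>m n"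
      using HH R RR by simp
    have "transpose_mat (H * R) * A * (H * R) = transpose_mat R * A' * R"
      unfolding P_transpose A'_def using H R RT A by (simp add: assoc_mult_mat[of _ n n _ n _ n])
    then show "transpose_mat (H * R) * A * (H * R) = mat n n (\<lambda>(i, j). if i = j then (e # es) ! i else 0)"
      using RA'R by simp
  qed
qed

section \<open>Spectral contraction of the averaging iteration\<close>

lemma orthogonal_mat_transpose_scalar_prod:
  fixes P :: "real mat"
  assumes P: "P \<in> carrier_mat n n" and PP: "P * transpose_mat P = 1\<^sub>m n"
    and x: "x \<in> carrier_vec n" and y: "y \<in> carrier_vec n"
  shows "(transpose_mat P *\<^sub>v x) \<bullet> (transpose_mat P *\<^sub>v y) = x \<bullet> y"
proof -
  have "(transpose_mat P *\<^sub>v x) \<bullet> (transpose_mat P *\<^sub>v y) = x \<bullet> (P *\<^sub>v (transpose_mat P *\<^sub>v y))"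
    using P x y by (intro transpose_vec_mult_scalar[of _ n n]) auto
  also have "P *\<^sub>v (transpose_mat P *\<^sub>v y) = y"
    using P y PP by (simp flip: assoc_mult_mat_vec[of _ n n _ n])
  finally show ?thesis .
qed

text \<open>
  The list from which \<^const>\<open>eigval_desc\<close> selects its entries; being zero-based, it has
  \<open>eigval_desc W k\<close> at index \<open>k - 1\<close>.
\<close>

definition eigvals_desc :: "real mat \<Rightarrow> real list" where
  "eigvals_desc W = rev (sorted_list_of_multiset (proots (char_poly W)))"

text \<open>
  For a symmetric matrix, the real roots of the characteristic polynomial are all its roots. Only
  because the list then has full length do its entries at indices \<open>1\<close> and \<open>n - 1\<close> really bound
  all eigenvalues other than the largest.
\<close>

lemma symmetric_eigvals_desc:
  assumes W: "W \<in> carrier_mat n n" and sym: "transpose_mat W = W"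
  shows "char_poly W = (\<Prod>e\<leftarrow>eigvals_desc W. [:- e, 1:])"
    and "length (eigvals_desc W) = n"
proof -
  obtain fs where fs: "char_poly W = (\<Prod>e\<leftarrow>fs. [:- e, 1:])"
    using symmetric_char_poly_splits[OF W sym] .
  have "proots (char_poly W) = (\<Sum>p\<leftarrow>map (\<lambda>e. [:- e, 1:]) fs. proots p)"
    unfolding fs using proots_prod_list[of "map (\<lambda>e. [:- e, 1:]) fs"] by (simp add: image_iff)
  also have "\<dots> = mset fs"
    by (induction fs) auto
  finally have "mset (eigvals_desc W) = mset fs"
    by (simp add: eigvals_desc_def)
  then have "(\<Prod>e\<in>#mset (eigvals_desc W). [:- e, 1:]) = (\<Prod>e\<in>#mset fs. [:- e, 1:])"
    by simp
  then show cp: "char_poly W = (\<Prod>e\<leftarrow>eigvals_desc W. [:- e, 1:])"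
    by (simp add: fs prod_mset_prod_list flip: mset_map)
  show "length (eigvals_desc W) = n"
    using degree_monic_char_poly[OF W] degree_linear_factors[of uminus "eigvals_desc W"]
    by (simp add: cp)
qed

lemma eigvals_desc_antimono:
  assumes "i \<le> j" and "j < length (eigvals_desc W)"
  shows "eigvals_desc W ! j \<le> eigvals_desc W ! i"
  using assms sorted_rev_nth_mono[of "eigvals_desc W" i j] by (simp add: eigvals_desc_def)

lemma abs_eigval_le_mu:
  assumes "dim_row W = n" and "length (eigvals_desc W) = n" and "1 \<le> k" and "k < n"
  shows "\<bar>eigvals_desc W ! k\<bar> \<le> mu W"
proof -
  have "eigvals_desc W ! k \<le> eigvals_desc W ! 1" "eigvals_desc W ! (n - 1) \<le> eigvals_desc W ! k"
    using assms by (auto intro!: eigvals_desc_antimono)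
  moreover have "mu W = max (eigvals_desc W ! 1) (- (eigvals_desc W ! (n - 1)))"
    using assms(1) by (simp add: mu_def eigval_desc_def eigvals_desc_def)
  ultimately show ?thesis
    by linarith
qed

lemma mu_nonneg:
  assumes "W \<in> carrier_mat n n" and "transpose_mat W = W" and "2 \<le> n"
  shows "0 \<le> mu W"
  using abs_eigval_le_mu[of W n 1] symmetric_eigvals_desc(2)[OF assms(1,2)] assms by auto

text \<open>
  In an orthonormal eigenbasis, ordered by decreasing eigenvalue, the all-ones vector has
  eigenvalue 1, whereas every basis vector but the first has an eigenvalue of modulus at most
  $\mu(W) < 1$. Hence the all-ones vector is a multiple of the first basis vector. A vector
  orthogonal to it has no first coordinate, and every other coordinate shrinks by $\mu(W)$.
\<close>

lemma contraction_on_mean_zero_vectors: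
  assumes W: "W \<in> carrier_mat n n" and sym: "transpose_mat W = W"
    and ones: "W *\<^sub>v vec n (\<lambda>_. 1) = vec n (\<lambda>_. 1)" and mu_less: "mu W < 1"
    and x: "x \<in> carrier_vec n" and mean0: "x \<bullet> vec n (\<lambda>_. 1) = 0"
  shows "(W *\<^sub>v x) \<bullet> (W *\<^sub>v x) \<le> (mu W)\<^sup>2 * (x \<bullet> x)"
proof (cases "n = 0")
  case True
  then show ?thesis using W x by (auto simp: scalar_prod_def)
next
  case False
  let ?es = "eigvals_desc W" and ?one = "vec n (\<lambda>_. 1) :: real vec"
  note cp = symmetric_eigvals_desc(1)[OF W sym] and len = symmetric_eigvals_desc(2)[OF W sym]
  obtain P where P: "P \<in> carrier_mat n n" and PTP: "transpose_mat P * P = 1\<^sub>m n"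
    and diag: "transpose_mat P * W * P = mat n n (\<lambda>(i, j). if i = j then ?es ! i else 0)"
    using symmetric_orthogonal_diagonalization[OF W sym cp] by auto
  have PT: "transpose_mat P \<in> carrier_mat n n" using P by simp
  have PPT: "P * transpose_mat P = 1\<^sub>m n"
    using mat_mult_left_right_inverse[OF PT P PTP] .
  note isometry = orthogonal_mat_transpose_scalar_prod[OF P PPT]
  have coord: "(transpose_mat P *\<^sub>v (W *\<^sub>v u)) $ k = ?es ! k * (transpose_mat P *\<^sub>v u) $ k"
    if u: "u \<in> carrier_vec n" and k: "k < n" for u k
  proof -
    define w where "w = transpose_mat P *\<^sub>v u"
    have w: "w \<in> carrier_vec n" using PT u by (simp add: w_def)
    have "P *\<^sub>v w = u"
      unfolding w_def using P u PPT by (simp flip: assoc_mult_mat_vec[of _ n n _ n])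
    then have "transpose_mat P *\<^sub>v (W *\<^sub>v u) = (transpose_mat P * W * P) *\<^sub>v w"
      using P PT W w by (simp add: assoc_mult_mat_vec[of _ n n _ n])
    also have "\<dots> $ k = (\<Sum>j = 0..<n. (if k = j then ?es ! k else 0) * w $ j)"
      unfolding diag using k w by (simp add: scalar_prod_def)
    also have "\<dots> = (\<Sum>j = 0..<n. if k = j then ?es ! k * w $ j else 0)"
      by (intro sum.cong) auto
    finally show ?thesis using k by (simp add: w_def)
  qed
  \<comment> \<open>coordinates of the all-ones vector and of \<open>x\<close> in the eigenbasis\<close>
  define y where "y = transpose_mat P *\<^sub>v ?one"
  define z where "z = transpose_mat P *\<^sub>v x"
  have y: "y \<in> carrier_vec n" and z: "z \<in> carrier_vec n"
    using PT x by (simp_all add: y_def z_def)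
  have y0: "y $ k = 0" if "1 \<le> k" "k < n" for k
  proof -
    have "y $ k = ?es ! k * y $ k"
      using coord[of ?one k] that by (simp add: y_def ones)
    moreover have "?es ! k < 1"
      using abs_eigval_le_mu[of W n k] W len that mu_less by auto
    ultimately show ?thesis by simp
  qed
  have only_0: "u \<bullet> y = u $ 0 * y $ 0" if "u \<in> carrier_vec n" for u
  proof -
    have "u \<bullet> y = (\<Sum>k = 0..<n. u $ k * y $ k)"
      using y by (simp add: scalar_prod_def)
    also have "\<dots> = (\<Sum>k\<in>{0}. u $ k * y $ k)"
      using False y0 by (intro sum.mono_neutral_right) auto
    finally show ?thesis by simp
  qed
  have "z $ 0 * y $ 0 = 0"
    using only_0[OF z] isometry[OF x, of ?one] mean0 by (simp add: y_def z_def)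
  moreover have "y $ 0 * y $ 0 = real n"
    using only_0[OF y] isometry[of ?one ?one] by (simp add: y_def scalar_prod_def)
  ultimately have z0: "z $ 0 = 0"
    using False by auto
  have Wx: "W *\<^sub>v x \<in> carrier_vec n" using W x by simp
  have "(W *\<^sub>v x) \<bullet> (W *\<^sub>v x) = (\<Sum>k = 0..<n. (?es ! k * z $ k) * (?es ! k * z $ k))"
    using isometry[OF Wx Wx] coord[OF x] PT by (simp add: scalar_prod_def z_def)
  also have "\<dots> \<le> (\<Sum>k = 0..<n. (mu W)\<^sup>2 * (z $ k * z $ k))"
  proof (rule sum_mono)
    fix k assume k: "k \<in> {0..<n}"
    show "(?es ! k * z $ k) * (?es ! k * z $ k) \<le> (mu W)\<^sup>2 * (z $ k * z $ k)"
    proof (cases "k = 0")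
      case True
      then show ?thesis by (simp add: z0)
    next
      case False
      then have "\<bar>?es ! k\<bar> \<le> \<bar>mu W\<bar>"
        using abs_eigval_le_mu[of W n k] W len k by auto
      then have "(?es ! k)\<^sup>2 * (z $ k)\<^sup>2 \<le> (mu W)\<^sup>2 * (z $ k)\<^sup>2"
        by (intro mult_right_mono) (auto simp: abs_le_square_iff)
      then show ?thesis
        by (simp add: power2_eq_square mult_ac)
    qed
  qed
  also have "\<dots> = (mu W)\<^sup>2 * (z \<bullet> z)"
    using z by (simp add: scalar_prod_def sum_distrib_left)
  also have "z \<bullet> z = x \<bullet> x"
    unfolding z_def by (rule isometry[OF x x])
  finally show ?thesis .
qed

lemma mix_Suc_matrix:
  assumes "pair_graph G" and verts: "pverts G = {..<n}" and W: "admissible_weights n G W" and i: "i < n"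
  shows "mix G W x (Suc t) i v = (\<Sum>j<n. W $$ (i, j) * mix G W x t j v)"
proof -
  interpret pair_graph G by fact
  have sub: "neighbours G i \<subseteq> {..<n} - {i}"
    using pair_no_loops[of "(i, i)"] verts by (auto simp: neighbours_def)
  have "(\<Sum>j<n. W $$ (i, j) * mix G W x t j v)
      = W $$ (i, i) * mix G W x t i v + (\<Sum>j\<in>{..<n} - {i}. W $$ (i, j) * mix G W x t j v)"
    using i by (intro sum.remove) auto
  also have "(\<Sum>j\<in>{..<n} - {i}. W $$ (i, j) * mix G W x t j v)
      = (\<Sum>j\<in>neighbours G i. W $$ (i, j) * mix G W x t j v)"
    using sub W i verts
    by (intro sum.mono_neutral_right) (auto simp: neighbours_def admissible_weights_def)
  finally show ?thesis by simp
qed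

text \<open>
  The deviations from the mean form a mean-zero vector: row sums 1 let $W$ commute with subtracting
  the mean, and symmetry keeps the total unchanged. So each step contracts them by $\mu(W)$. The
  factor $\sqrt n$ comes from bounding the initial deviation in Euclidean norm, one term per agent,
  and a single coordinate never exceeds the norm.
\<close>

lemma mix_error:
  fixes x :: "nat \<Rightarrow> 'a \<Rightarrow> real"
  assumes G: "pair_graph G" "pverts G = {..<n}" and W: "admissible_weights n G W" and n: "2 \<le> n"
    and x: "\<And>j. j < n \<Longrightarrow> 0 \<le> x j v" "\<And>j. j < n \<Longrightarrow> x j v \<le> F"
    and i: "i < n"
  shows "\<bar>mix G W x t i v - (1 / real n) * (\<Sum>j<n. x j v)\<bar> \<le> sqrt (real n) * mu W ^ t * F"
proof -
  define avg where "avg = (1 / real n) * (\<Sum>j<n. x j v)"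
  define d where "d t = vec n (\<lambda>j. mix G W x t j v - avg)" for t
  let ?one = "vec n (\<lambda>_. 1) :: real vec"
  have Wc: "W \<in> carrier_mat n n" and sym: "transpose_mat W = W" and ones: "W *\<^sub>v ?one = ?one"
    and mu1: "mu W < 1"
    using W by (auto simp: admissible_weights_def)
  have mu0: "0 \<le> mu W"
    using mu_nonneg[OF Wc sym n] .
  have F0: "0 \<le> F" using x[OF i] by linarith
  have row_sum: "(\<Sum>j<n. W $$ (k, j)) = 1" if "k < n" for k
    using arg_cong[OF ones, of "\<lambda>u. u $ k"] that Wc
    by (simp add: scalar_prod_def lessThan_atLeast0)
  have d: "d t \<in> carrier_vec n" for t by (simp add: d_def)
  have d_Suc: "d (Suc t) = W *\<^sub>v d t" for t
  proof (rule eq_vecI)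
    fix k assume "k < dim_vec (W *\<^sub>v d t)"
    then have k: "k < n" using Wc by simp
    have "(W *\<^sub>v d t) $ k = (\<Sum>j<n. W $$ (k, j) * (mix G W x t j v - avg))"
      using k Wc by (simp add: scalar_prod_def d_def lessThan_atLeast0)
    also have "\<dots> = (\<Sum>j<n. W $$ (k, j) * mix G W x t j v) - (\<Sum>j<n. W $$ (k, j)) * avg"
      by (simp add: algebra_simps sum_subtractf sum_distrib_left)
    finally show "d (Suc t) $ k = (W *\<^sub>v d t) $ k"
      using k by (simp add: row_sum d_def mix_Suc_matrix[OF G W] del: mix.simps)
  qed (use Wc in \<open>simp add: d_def\<close>)
  have "d t \<bullet> ?one = 0 \<and> d t \<bullet> d t \<le> (mu W ^ t)\<^sup>2 * (d 0 \<bullet> d 0)" for t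
  proof (induction t)
    case 0
    have "d 0 \<bullet> ?one = (\<Sum>j<n. x j v) - real n * avg"
      by (simp add: d_def scalar_prod_def sum_subtractf lessThan_atLeast0)
    then show ?case using n by (simp add: avg_def)
  next
    case (Suc t)
    have "d (Suc t) \<bullet> ?one = ?one \<bullet> (W *\<^sub>v d t)"
      unfolding d_Suc using Wc d by (intro comm_scalar_prod[of _ n]) auto
    also have "\<dots> = (transpose_mat W *\<^sub>v ?one) \<bullet> d t"
      using Wc d by (intro transpose_vec_mult_scalar[symmetric, of _ n n]) auto
    also have "\<dots> = 0"
      using Suc.IH d by (simp add: sym ones comm_scalar_prod[of ?one n])
    finally have "d (Suc t) \<bullet> ?one = 0" .
    moreover have "d (Suc t) \<bullet> d (Suc t) \<le> (mu W)\<^sup>2 * (d t \<bullet> d t)"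
      unfolding d_Suc using contraction_on_mean_zero_vectors[OF Wc sym ones mu1 d] Suc.IH by blast
    moreover have "(mu W)\<^sup>2 * (d t \<bullet> d t) \<le> (mu W)\<^sup>2 * ((mu W ^ t)\<^sup>2 * (d 0 \<bullet> d 0))"
      using Suc.IH by (intro mult_left_mono) auto
    ultimately show ?case by (simp add: power_mult_distrib mult.assoc)
  qed
  then have step: "d t \<bullet> d t \<le> (mu W ^ t)\<^sup>2 * (d 0 \<bullet> d 0)" by blast
  have "d 0 \<bullet> d 0 = (\<Sum>j<n. (x j v - avg)\<^sup>2)"
    by (simp add: d_def scalar_prod_def lessThan_atLeast0 power2_eq_square)
  also have "\<dots> \<le> (\<Sum>j<n. F\<^sup>2)"
  proof (rule sum_mono)
    fix j assume "j \<in> {..<n}"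
    have "0 \<le> avg"
      unfolding avg_def using x(1) by (intro mult_nonneg_nonneg sum_nonneg) auto
    moreover have "(\<Sum>j<n. x j v) \<le> real n * F"
      using sum_mono[of "{..<n}" "\<lambda>j. x j v" "\<lambda>_. F"] x(2) by simp
    then have "avg \<le> F"
      using n by (simp add: avg_def field_simps)
    ultimately have "\<bar>x j v - avg\<bar> \<le> \<bar>F\<bar>"
      using x[of j] \<open>j \<in> {..<n}\<close> by auto
    then show "(x j v - avg)\<^sup>2 \<le> F\<^sup>2"
      by (simp only: abs_le_square_iff)
  qed
  finally have d0: "d 0 \<bullet> d 0 \<le> real n * F\<^sup>2" by simp
  have "(mix G W x t i v - avg)\<^sup>2 = d t $ i * d t $ i"
    using i by (simp add: d_def power2_eq_square)
  also have "\<dots> \<le> d t \<bullet> d t"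
    unfolding scalar_prod_def using i d[of t] by (intro member_le_sum) auto
  also have "\<dots> \<le> (mu W ^ t)\<^sup>2 * (real n * F\<^sup>2)"
    using step d0 by (meson mult_left_mono order_trans zero_le_power2)
  also have "\<dots> = (sqrt (real n) * mu W ^ t * F)\<^sup>2"
    by (simp add: power_mult_distrib)
  finally have "\<bar>mix G W x t i v - avg\<bar> \<le> \<bar>sqrt (real n) * mu W ^ t * F\<bar>"
    by (simp only: abs_le_square_iff)
  then show ?thesis
    using mu0 F0 by (simp add: avg_def abs_mult)
qed

section \<open>Agreement by repeated intersection\<close>

text \<open>
  One step along each arc of the path passes the constraint of \<open>j\<close> back towards \<open>i\<close>. Since an
  agent also intersects with its own set, surplus steps lose nothing.
\<close>

lemma intersect_steps_subset:
  assumes "pair_graph G" and "pre_digraph.apath (with_proj G) i p j" and "length p \<le> s"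
  shows "intersect_steps G C s i \<subseteq> C j"
proof -
  interpret pair_graph G by fact
  have "intersect_steps G C (length p + r) i \<subseteq> C j" for r
    using assms(2)
  proof (induction p arbitrary: i)
    case Nil
    have "intersect_steps G C r i \<subseteq> C i"
      by (induction r) auto
    then show ?case using Nil by (simp add: apath_Nil_iff)
  next
    case (Cons e p)
    then have e: "e \<in> parcs G" "fst e = i" "apath (snd e) p j"
      by (auto simp: apath_Cons_iff)
    then have "snd e \<in> neighbours G i"
      using arc_snd_in_verts[of e] by (cases e) (auto simp: neighbours_def)
    then have "intersect_steps G C (length (e # p) + r) i \<subseteq> intersect_steps G C (length p + r) (snd e)"
      by auto
    also have "\<dots> \<subseteq> C j"
      using Cons.IH e(3) by blast
    finally show ?case .
  qed
  from this[of "s - length p"] show ?thesis using assms(3) by simp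
qed

lemma short_apath_exists:
  assumes "pair_graph G" and "Digraph_Component.connected (with_proj G)"
    and i: "i \<in> pverts G" and j: "j \<in> pverts G"
  obtains p where "pre_digraph.apath (with_proj G) i p j" "length p \<le> graph_diameter G"
proof -
  interpret pair_graph G by fact
  have "strongly_connected (with_proj G)"
    using symmetric_connected_imp_strongly_connected pair_sym_arcs assms(2) by blast
  then have "\<exists>p. apath i p j"
    using i j reachable_apath by (auto simp: strongly_connected_def)
  then have "\<exists>l p. apath i p j \<and> length p = l" by blast
  then have "\<exists>p. apath i p j \<and> length p = graph_dist G i j"
    unfolding graph_dist_def by (rule LeastI_ex)
  then obtain p where p: "apath i p j" "length p = graph_dist G i j" by blast
  have "{graph_dist G i j | i j. i \<in> pverts G \<and> j \<in> pverts G}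
      = (\<lambda>(i, j). graph_dist G i j) ` (pverts G \<times> pverts G)"
    by auto
  then have "finite {graph_dist G i j | i j. i \<in> pverts G \<and> j \<in> pverts G}"
    using pair_finite_verts by simp
  then have "graph_dist G i j \<le> graph_diameter G"
    unfolding graph_diameter_def using i j by (intro Max_ge) auto
  with p that show ?thesis by simp
qed

text \<open>
  After as many steps as the diameter, every constraint has reached every agent, so the result no
  longer depends on \<open>i\<close>; this is what makes the agents choose the same element.
\<close>

lemma intersect_steps_diameter:
  assumes G: "pair_graph G" "Digraph_Component.connected (with_proj G)" and i: "i \<in> pverts G"
  shows "intersect_steps G C (graph_diameter G) i = (\<Inter>j\<in>pverts G. C j)"
proof
  show "intersect_steps G C (graph_diameter G) i \<subseteq> (\<Inter>j\<in>pverts G. C j)"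
  proof
    fix v assume v: "v \<in> intersect_steps G C (graph_diameter G) i"
    show "v \<in> (\<Inter>j\<in>pverts G. C j)"
    proof
      fix j assume "j \<in> pverts G"
      then obtain p where "pre_digraph.apath (with_proj G) i p j" "length p \<le> graph_diameter G"
        using short_apath_exists[OF G i] by metis
      from intersect_steps_subset[OF G(1) this, of C] v show "v \<in> C j" ..
    qed
  qed
  have "(\<Inter>j\<in>pverts G. C j) \<subseteq> intersect_steps G C s i" for s
    using i
  proof (induction s arbitrary: i)
    case 0
    then show ?case by (simp add: INF_lower)
  next
    case (Suc s)
    have "(\<Inter>j\<in>pverts G. C j) \<subseteq> intersect_steps G C s k" if "k \<in> neighbours G i \<union> {i}" for k
      using that Suc.prems by (intro Suc.IH) (auto simp: neighbours_def)
    then show ?case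
      unfolding intersect_steps.simps by (rule INF_greatest)
  qed
  then show "(\<Inter>j\<in>pverts G. C j) \<subseteq> intersect_steps G C (graph_diameter G) i" .
qed

section \<open>Submodularity ratio\<close>

definition weakly_submodular :: "'a set \<Rightarrow> ('a set \<Rightarrow> real) \<Rightarrow> real \<Rightarrow> bool" where
  "weakly_submodular V g \<gamma> \<longleftrightarrow>
     (\<forall>A\<subseteq>V. \<forall>B\<subseteq>V. \<gamma> * (g (A \<union> B) - g B) \<le> (\<Sum>a\<in>A - B. g ({a} \<union> B) - g B))"

text \<open>
  The admissible factors form a compact set, because each inequality is a closed condition on
  $\gamma$, and monotonicity puts 0 into it. So a largest one exists, as the \<open>GREATEST\<close> operator
  needs in order to denote anything.
\<close>

lemma submodularity_ratio_attained:
  assumes "mono_on (Pow V) g"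
  shows "0 \<le> submodularity_ratio V g" and "submodularity_ratio V g \<le> 1"
    and "weakly_submodular V g (submodularity_ratio V g)"
proof -
  define R where "R = {0..1} \<inter>
    (\<Inter>A\<in>Pow V. \<Inter>B\<in>Pow V. {\<gamma>. \<gamma> * (g (A \<union> B) - g B) \<le> (\<Sum>a\<in>A - B. g ({a} \<union> B) - g B)})"
  have R_iff: "\<gamma> \<in> R \<longleftrightarrow> 0 \<le> \<gamma> \<and> \<gamma> \<le> 1 \<and> weakly_submodular V g \<gamma>" for \<gamma>
    by (auto simp: R_def weakly_submodular_def)
  have "closed {\<gamma>. \<gamma> * (g (A \<union> B) - g B) \<le> (\<Sum>a\<in>A - B. g ({a} \<union> B) - g B)}" for A B
    by (intro closed_Collect_le continuous_intros)
  then have "compact R"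
    unfolding R_def by (intro compact_Int_closed closed_INT) auto
  moreover have "0 \<in> R"
  proof -
    have "0 \<le> (\<Sum>a\<in>A - B. g ({a} \<union> B) - g B)" if "A \<subseteq> V" "B \<subseteq> V" for A B
    proof (intro sum_nonneg)
      fix a assume "a \<in> A - B"
      then show "0 \<le> g ({a} \<union> B) - g B"
        using mono_onD[OF assms, of B "{a} \<union> B"] that by auto
    qed
    then show ?thesis by (simp add: R_iff weakly_submodular_def)
  qed
  ultimately obtain s where s: "s \<in> R" "\<And>\<gamma>. \<gamma> \<in> R \<Longrightarrow> \<gamma> \<le> s"
    using compact_attains_sup[of R] by blast
  have "submodularity_ratio V g = s"
    unfolding submodularity_ratio_def
    by (rule Greatest_equality) (use s in \<open>auto simp: R_iff weakly_submodular_def\<close>)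
  with s(1) show "0 \<le> submodularity_ratio V g" "submodularity_ratio V g \<le> 1"
    "weakly_submodular V g (submodularity_ratio V g)"
    by (simp_all add: R_iff)
qed

text \<open>
  The inequality is linear in the set function, so it survives averaging once a common factor is
  used. Lowering each factor to $\gamma$ is harmless because monotonicity makes the multiplied
  difference nonnegative.
\<close>

lemma weakly_submodular_mean:
  assumes V: "\<And>i. i < n \<Longrightarrow> mono_on (Pow V) (f i)"
    and sub: "\<And>i. i < n \<Longrightarrow> weakly_submodular V (f i) (r i)"
    and \<gamma>: "\<And>i. i < n \<Longrightarrow> \<gamma> \<le> r i"
  shows "weakly_submodular V (\<lambda>S. (1 / real n) * (\<Sum>i<n. f i S)) \<gamma>"
  unfolding weakly_submodular_def
proof (intro allI impI)
  fix A B assume A: "A \<subseteq> V" and B: "B \<subseteq> V"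
  have "\<gamma> * (f i (A \<union> B) - f i B) \<le> (\<Sum>a\<in>A - B. f i ({a} \<union> B) - f i B)" if i: "i < n" for i
  proof -
    have "f i B \<le> f i (A \<union> B)"
      using mono_onD[OF V[OF i], of B "A \<union> B"] A B by auto
    then have "\<gamma> * (f i (A \<union> B) - f i B) \<le> r i * (f i (A \<union> B) - f i B)"
      using \<gamma>[OF i] by (intro mult_right_mono) auto
    also have "\<dots> \<le> (\<Sum>a\<in>A - B. f i ({a} \<union> B) - f i B)"
      using sub[OF i] A B by (simp add: weakly_submodular_def)
    finally show ?thesis .
  qed
  then have "(1 / real n) * (\<Sum>i<n. \<gamma> * (f i (A \<union> B) - f i B))
      \<le> (1 / real n) * (\<Sum>i<n. \<Sum>a\<in>A - B. f i ({a} \<union> B) - f i B)"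
    by (intro mult_left_mono sum_mono) auto
  also have "(1 / real n) * (\<Sum>i<n. \<gamma> * (f i (A \<union> B) - f i B))
      = \<gamma> * ((1 / real n) * (\<Sum>i<n. f i (A \<union> B)) - (1 / real n) * (\<Sum>i<n. f i B))"
    by (simp add: sum_subtractf sum_distrib_left algebra_simps)
  also have "(\<Sum>i<n. \<Sum>a\<in>A - B. f i ({a} \<union> B) - f i B)
      = (\<Sum>a\<in>A - B. \<Sum>i<n. f i ({a} \<union> B) - f i B)"
    by (rule sum.swap)
  also have "(1 / real n) * (\<Sum>a\<in>A - B. \<Sum>i<n. f i ({a} \<union> B) - f i B)
      = (\<Sum>a\<in>A - B. (1 / real n) * (\<Sum>i<n. f i ({a} \<union> B)) - (1 / real n) * (\<Sum>i<n. f i B))"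
    by (simp add: sum_subtractf sum_distrib_left algebra_simps)
  finally show "\<gamma> * ((1 / real n) * (\<Sum>i<n. f i (A \<union> B)) - (1 / real n) * (\<Sum>i<n. f i B))
      \<le> (\<Sum>a\<in>A - B. (1 / real n) * (\<Sum>i<n. f i ({a} \<union> B)) - (1 / real n) * (\<Sum>i<n. f i B))" .
qed

section \<open>Greedy maximization with inexact choices\<close>

text \<open>
  Weak submodularity bounds $\gamma$ times the missing value by the summed gains of the at most
  $K$ elements of the optimum that are absent from $S$, and each of these gains is at most the gain
  of $v$ plus $\delta$. So adding $v$ closes at least the fraction $\gamma / K$ of the gap, up to
  the error $\delta$.
\<close>

lemma approximate_greedy_step:
  assumes V: "finite V" and mono: "mono_on (Pow V) g" and sub: "weakly_submodular V g \<gamma>"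
    and opt: "Opt \<subseteq> V" "card Opt \<le> K" and K: "1 \<le> K" and S: "S \<subseteq> V" and v: "v \<in> V"
    and \<gamma>: "0 \<le> \<gamma>"
    and best: "\<And>u. u \<in> V - S \<Longrightarrow> g ({u} \<union> S) - g S \<le> g ({v} \<union> S) - g S + \<delta>"
    and \<delta>: "0 \<le> \<delta>"
  shows "g Opt - g ({v} \<union> S) \<le> (1 - \<gamma> / real K) * (g Opt - g S) + \<delta>"
proof -
  let ?gain = "g ({v} \<union> S) - g S + \<delta>"
  have gain0: "0 \<le> ?gain"
    using mono_onD[OF mono, of S "{v} \<union> S"] S v \<delta> by (auto simp: subset_insertI)
  have "\<gamma> * (g Opt - g S) \<le> \<gamma> * (g (Opt \<union> S) - g S)"
    using mono_onD[OF mono, of Opt "Opt \<union> S"] opt S \<gamma> by (intro mult_left_mono) auto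
  also have "\<dots> \<le> (\<Sum>a\<in>Opt - S. g ({a} \<union> S) - g S)"
    using sub opt S by (simp add: weakly_submodular_def)
  also have "\<dots> \<le> (\<Sum>a\<in>Opt - S. ?gain)"
    using best opt by (intro sum_mono) auto
  also have "\<dots> = real (card (Opt - S)) * ?gain"
    by simp
  also have "\<dots> \<le> real K * ?gain"
    using gain0 opt card_mono[of Opt "Opt - S"] finite_subset[OF opt(1) V]
    by (intro mult_right_mono) auto
  finally have "\<gamma> / real K * (g Opt - g S) \<le> ?gain"
    using K by (simp add: pos_divide_le_eq mult.commute)
  then show ?thesis
    by (simp add: left_diff_distrib)
qed

lemma approximate_contraction_iterate:
  fixes gap :: "nat \<Rightarrow> real"
  assumes step: "\<And>k. k < m \<Longrightarrow> gap (Suc k) \<le> q * gap k + \<delta>"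
    and q: "0 \<le> q" "q \<le> 1" and \<delta>: "0 \<le> \<delta>"
  shows "gap m \<le> q ^ m * gap 0 + real m * \<delta>"
  using step
proof (induction m)
  case 0
  then show ?case by simp
next
  case (Suc m)
  have "gap (Suc m) \<le> q * gap m + \<delta>" using Suc.prems by simp
  also have "\<dots> \<le> q * (q ^ m * gap 0 + real m * \<delta>) + \<delta>"
    using Suc q by (intro add_right_mono mult_left_mono) auto
  also have "\<dots> = q ^ Suc m * gap 0 + q * (real m * \<delta>) + \<delta>"
    by (simp add: algebra_simps)
  also have "\<dots> \<le> q ^ Suc m * gap 0 + 1 * (real m * \<delta>) + \<delta>"
    using q \<delta> by (intro add_right_mono add_left_mono mult_right_mono) auto
  finally show ?case by (simp add: algebra_simps)
qed

lemma power_one_minus_le_exp: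
  assumes "0 \<le> \<gamma>" "\<gamma> \<le> real K" "1 \<le> K"
  shows "(1 - \<gamma> / real K) ^ K \<le> exp (- \<gamma>)"
proof -
  have "(1 - \<gamma> / real K) ^ K \<le> exp (- \<gamma> / real K) ^ K"
    using assms exp_ge_add_one_self[of "- \<gamma> / real K"] by (intro power_mono) (auto simp: field_simps)
  also have "\<dots> = exp (- \<gamma>)"
    using assms by (simp flip: exp_of_nat_mult)
  finally show ?thesis .
qed

section \<open>Consensus and quality of one round\<close>

text \<open>
  Here \<open>x i\<close> is the estimate by agent \<open>i\<close> of the true value \<open>a\<close>. An exact maximizer of \<open>a\<close> can
  fall behind the best estimate by at most $2\epsilon \le \psi$, so no agent discards it.
  Conversely, whatever an agent keeps lies within $\psi$ of the best estimate; comparing with true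
  values costs another $\epsilon$ on either side.
\<close>

lemma approximate_maximizers:
  fixes x :: "nat \<Rightarrow> 'a \<Rightarrow> real"
  assumes X: "finite X" "X \<noteq> {}" and n: "0 < n"
    and err: "\<And>i u. i < n \<Longrightarrow> u \<in> X \<Longrightarrow> \<bar>x i u - a u\<bar> \<le> \<epsilon>" and \<psi>: "2 * \<epsilon> \<le> \<psi>"
    and C: "\<And>i. C i = {v \<in> X. Max (x i ` X) - \<psi> \<le> x i v}"
  shows "(\<Inter>i<n. C i) \<noteq> {}"
    and "\<And>v u. v \<in> (\<Inter>i<n. C i) \<Longrightarrow> u \<in> X \<Longrightarrow> a u \<le> a v + (\<psi> + 2 * \<epsilon>)"
proof -
  have "Max (a ` X) \<in> a ` X" using X by simp
  then obtain m where m: "m \<in> X" "a m = Max (a ` X)" by auto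
  then have a_le: "a u \<le> a m" if "u \<in> X" for u using X that by simp
  have "m \<in> C i" if i: "i < n" for i
  proof -
    have "x i u \<le> x i m + \<psi>" if "u \<in> X" for u
      using err[OF i that] err[OF i m(1)] a_le[OF that] \<psi> by linarith
    then have "Max (x i ` X) \<le> x i m + \<psi>"
      using X by (intro Max.boundedI) auto
    then show ?thesis using m by (simp add: C)
  qed
  then show "(\<Inter>i<n. C i) \<noteq> {}" by blast
  fix v u assume v: "v \<in> (\<Inter>i<n. C i)" and u: "u \<in> X"
  have "v \<in> C 0" using v n by auto
  then have v0: "v \<in> X" "Max (x 0 ` X) - \<psi> \<le> x 0 v" by (auto simp: C)
  have "x 0 u \<le> Max (x 0 ` X)" using X u by simp
  then show "a u \<le> a v + (\<psi> + 2 * \<epsilon>)"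
    using err[OF n u] err[OF n v0(1)] v0(2) by linarith
qed

text \<open>
  From a common set \<open>A\<close>, the averaging iteration gives every agent $\epsilon$-accurate estimates
  of the mean marginal gains; the initial gains lie in $[0, F_h]$ by monotonicity. The agents then
  intersect their candidates down to the same set, which is nonempty and contains only near-best
  elements, and the common labelling makes them pick the same one.
\<close>

lemma dga_round_adds_common_approximate_maximizer:
  fixes f :: "nat \<Rightarrow> 'a set \<Rightarrow> real" and n T :: nat and F\<^sub>h :: real
  assumes g: "g = (\<lambda>S. (1 / real n) * (\<Sum>i<n. f i S))" and n: "2 \<le> n" and V: "finite V" and lab: "bij_betw lab {1..card V} V"
    and nonneg: "\<And>i A. i < n \<Longrightarrow> A \<subseteq> V \<Longrightarrow> 0 \<le> f i A"
    and mono: "\<And>i. i < n \<Longrightarrow> mono_on (Pow V) (f i)"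
    and G: "pair_graph G" "pverts G = {..<n}" "Digraph_Component.connected (with_proj G)"
    and W: "admissible_weights n G W"
    and F\<^sub>h: "\<And>i. i < n \<Longrightarrow> f i V \<le> F\<^sub>h"
    and \<epsilon>: "\<epsilon> = sqrt (real n) * mu W ^ T * F\<^sub>h" and \<psi>: "2 * \<epsilon> \<le> \<psi>"
    and T': "T' = T + 1 + graph_diameter G"
    and S: "\<forall>i<n. S i = A" and A: "A \<subset> V"
  shows "\<exists>v \<in> V - A. (\<forall>i<n. dga_round V lab f G W T T' \<psi> S i = {v} \<union> A) \<and>
    (\<forall>u \<in> V - A. g ({u} \<union> A) - g A \<le> g ({v} \<union> A) - g A + (\<psi> + 2 * \<epsilon>))"
proof -
  define x where "x = mix G W (local_gain f S) T"
  define C where "C i = {v \<in> V - A. Max (x i ` (V - A)) - \<psi> \<le> x i v}" for i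
  have X: "finite (V - A)" "V - A \<noteq> {}" and n0: "0 < n" using V A n by auto
  have gain: "local_gain f S i u = f i ({u} \<union> A) - f i A" if "i < n" for i u
    using S that by (simp add: local_gain_def)
  have err: "\<bar>x i u - (g ({u} \<union> A) - g A)\<bar> \<le> \<epsilon>" if i: "i < n" and u: "u \<in> V - A" for i u
  proof -
    have "0 \<le> local_gain f S j u" "local_gain f S j u \<le> F\<^sub>h" if j: "j < n" for j
    proof -
      have uA: "{u} \<union> A \<subseteq> V" "A \<subseteq> V" using u A by auto
      have "f j A \<le> f j ({u} \<union> A)" "f j ({u} \<union> A) \<le> f j V"
        using uA by (auto intro!: mono_onD[OF mono[OF j]])
      then show "0 \<le> local_gain f S j u" "local_gain f S j u \<le> F\<^sub>h"
        using nonneg[OF j uA(2)] F\<^sub>h[OF j] gain[OF j, of u] by linarith+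
    qed
    then have "\<bar>x i u - (1 / real n) * (\<Sum>j<n. local_gain f S j u)\<bar> \<le> \<epsilon>"
      unfolding x_def \<epsilon> by (intro mix_error[OF G(1,2) W n _ _ i])
    also have "(1 / real n) * (\<Sum>j<n. local_gain f S j u) = g ({u} \<union> A) - g A"
      by (simp add: g gain sum_subtractf right_diff_distrib)
    finally show ?thesis .
  qed
  define I where "I = (\<Inter>i<n. C i)"
  have I_nonempty: "I \<noteq> {}"
    unfolding I_def by (rule approximate_maximizers(1)[OF X n0 err \<psi> C_def])
  have I_best: "g ({u} \<union> A) - g A \<le> g ({v} \<union> A) - g A + (\<psi> + 2 * \<epsilon>)"
    if v: "v \<in> I" and u: "u \<in> V - A" for u v
    by (rule approximate_maximizers(2)[where a = "\<lambda>u. g ({u} \<union> A) - g A" and x = x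
          and n = n and C = C and X = "V - A"]; fact X n0 err \<psi> C_def v[unfolded I_def] u)
  have I_sub: "I \<subseteq> V - A"
    using n0 by (auto simp: I_def C_def)
  have agree: "intersect_steps G (candidates V \<psi> S x) (T' - (T + 1)) i = I" if "i < n" for i
  proof -
    have "T' - (T + 1) = graph_diameter G" by (simp add: T')
    then have "intersect_steps G (candidates V \<psi> S x) (T' - (T + 1)) i = (\<Inter>j<n. candidates V \<psi> S x j)"
      using intersect_steps_diameter[OF G(1,3), of i "candidates V \<psi> S x"] that G(2) by simp
    also have "\<dots> = I"
      unfolding I_def C_def by (intro INF_cong) (auto simp: candidates_def S)
    finally show ?thesis .
  qed
  define J where "J = {j \<in> {1..card V}. lab j \<in> I}"
  obtain m where "m \<in> I" using I_nonempty by blast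
  then have "m \<in> lab ` {1..card V}" using I_sub lab by (auto simp: bij_betw_def)
  then have "J \<noteq> {}" using \<open>m \<in> I\<close> by (auto simp: J_def)
  moreover have "finite J" by (simp add: J_def)
  ultimately have "Min J \<in> J" by simp
  then have "lab (Min J) \<in> I" by (simp add: J_def)
  show ?thesis
  proof (intro bexI[of _ "lab (Min J)"] conjI allI impI ballI)
    show "lab (Min J) \<in> V - A" using \<open>lab (Min J) \<in> I\<close> I_sub by blast
    show "dga_round V lab f G W T T' \<psi> S i = {lab (Min J)} \<union> A" if "i < n" for i
      using agree[OF that] S that unfolding dga_round_def x_def J_def by simp
    show "g ({u} \<union> A) - g A \<le> g ({lab (Min J)} \<union> A) - g A + (\<psi> + 2 * \<epsilon>)" if "u \<in> V - A" for u
      using I_best[OF \<open>lab (Min J) \<in> I\<close> that] .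
  qed
qed

section \<open>Performance guarantee of the distributed greedy algorithm\<close>

theorem corollary1:
  fixes V :: "'a set" and lab :: "nat \<Rightarrow> 'a" and f :: "nat \<Rightarrow> 'a set \<Rightarrow> real"
    and favg :: "'a set \<Rightarrow> real" and G :: "nat pair_pre_digraph" and W :: "real mat"
    and n K T T' :: nat and \<gamma>\<^sub>c F\<^sub>h \<epsilon> \<psi> :: real and Sopt :: "'a set"
  assumes "n \<ge> 2"
    and "finite V" and "bij_betw lab {1..card V} V"
    and "\<And>i A. i < n \<Longrightarrow> A \<subseteq> V \<Longrightarrow> f i A \<ge> 0"
    and "\<And>i. i < n \<Longrightarrow> mono_on (Pow V) (f i)"
    and "\<And>i. i < n \<Longrightarrow> f i {} = 0"
    and "\<And>i. i < n \<Longrightarrow> submodularity_ratio V (f i) > 0"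
    and "\<gamma>\<^sub>c = Min ((\<lambda>i. submodularity_ratio V (f i)) ` {..<n})"
    and "\<And>S. favg S = (1 / real n) * (\<Sum>i<n. f i S)"
    and "1 \<le> K" and "K \<le> card V"
    and "pair_graph G" and "pverts G = {..<n}" and "Digraph_Component.connected (with_proj G)"
    and "admissible_weights n G W"
    and "T \<ge> 1" and "T' = T + 1 + graph_diameter G"
    and "F\<^sub>h = Max ((\<lambda>i. f i V) ` {..<n})"
    and "\<epsilon> = sqrt (real n) * mu W ^ T * F\<^sub>h"
    and "\<psi> \<ge> 0" and "\<psi> \<ge> 4 * sqrt (real n) * mu W ^ T * F\<^sub>h"
    and "is_arg_max favg (\<lambda>S. S \<subseteq> V \<and> card S \<le> K) Sopt"
  shows "(\<forall>i<n. \<forall>j<n. dga V lab f G W T T' \<psi> K i = dga V lab f G W T T' \<psi> K j) \<and>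
    (\<forall>i<n. dga V lab f G W T T' \<psi> K i \<subseteq> V \<and>
           card (dga V lab f G W T T' \<psi> K i) \<le> K \<and>
           favg (dga V lab f G W T T' \<psi> K i)
             \<ge> (1 - exp (- \<gamma>\<^sub>c)) * favg Sopt - real K * (\<psi> + 2 * \<epsilon>))"
proof -
  let ?S = "dga V lab f G W T T' \<psi>" and ?\<rho> = "\<lambda>i. submodularity_ratio V (f i)"
  note n = assms(1) and V = assms(2) and nonneg = assms(4) and mono = assms(5) and W = assms(15)
  have favg: "favg = (\<lambda>S. (1 / real n) * (\<Sum>i<n. f i S))"
    using assms(9) by blast
  have F\<^sub>h: "f i V \<le> F\<^sub>h" if "i < n" for i
    using that by (simp add: assms(18))
  have "0 \<le> mu W"
    using W n by (intro mu_nonneg) (auto simp: admissible_weights_def)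
  moreover have "0 \<le> F\<^sub>h"
    using nonneg[of 0 V] F\<^sub>h[of 0] n by simp
  ultimately have \<epsilon>0: "0 \<le> \<epsilon>"
    by (simp add: assms(19))
  then have \<psi>: "2 * \<epsilon> \<le> \<psi>" and \<delta>0: "0 \<le> \<psi> + 2 * \<epsilon>"
    using assms(20,21) by (simp_all add: assms(19) mult.assoc)
  have "\<gamma>\<^sub>c \<in> ?\<rho> ` {..<n}" and \<gamma>_le: "\<gamma>\<^sub>c \<le> ?\<rho> i" if "i < n" for i
    unfolding assms(8) using that by (auto intro!: Min_in)
  then have \<gamma>: "0 \<le> \<gamma>\<^sub>c" "\<gamma>\<^sub>c \<le> 1"
    using submodularity_ratio_attained(1,2)[OF mono] n by fastforce+
  have mono_avg: "mono_on (Pow V) favg"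
    unfolding favg by (intro mono_onI mult_left_mono sum_mono) (auto intro!: mono_onD[OF mono])
  have sub_avg: "weakly_submodular V favg \<gamma>\<^sub>c"
    unfolding favg
    by (rule weakly_submodular_mean[OF mono submodularity_ratio_attained(3)[OF mono] \<gamma>_le])
  have opt: "Sopt \<subseteq> V" "card Sopt \<le> K"
    using assms(22) by (auto simp: is_arg_max_def)
  \<comment> \<open>Stated for an arbitrary common set \<open>A\<close>, so that it serves both consensus and the bound.\<close>
  have step: "\<exists>v \<in> V - A. (\<forall>i<n. ?S (Suc k) i = {v} \<union> A) \<and>
      favg Sopt - favg ({v} \<union> A) \<le> (1 - \<gamma>\<^sub>c / real K) * (favg Sopt - favg A) + (\<psi> + 2 * \<epsilon>)"
    if common: "\<forall>i<n. ?S k i = A" and A: "A \<subset> V" for k A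
  proof -
    have "\<exists>v \<in> V - A. (\<forall>i<n. dga_round V lab f G W T T' \<psi> (?S k) i = {v} \<union> A) \<and>
        (\<forall>u \<in> V - A. favg ({u} \<union> A) - favg A \<le> favg ({v} \<union> A) - favg A + (\<psi> + 2 * \<epsilon>))"
      by (rule dga_round_adds_common_approximate_maximizer[OF favg]; fact)
    then obtain v where v: "v \<in> V - A" "\<forall>i<n. dga_round V lab f G W T T' \<psi> (?S k) i = {v} \<union> A"
      "\<And>u. u \<in> V - A \<Longrightarrow> favg ({u} \<union> A) - favg A \<le> favg ({v} \<union> A) - favg A + (\<psi> + 2 * \<epsilon>)"
      by blast
    have "favg Sopt - favg ({v} \<union> A) \<le> (1 - \<gamma>\<^sub>c / real K) * (favg Sopt - favg A) + (\<psi> + 2 * \<epsilon>)"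
      by (rule approximate_greedy_step[OF V mono_avg sub_avg opt assms(10) _ _ \<gamma>(1) v(3) \<delta>0])
        (use v(1) A in auto)
    with v show ?thesis by auto
  qed
  have consensus: "\<exists>A. (\<forall>i<n. ?S k i = A) \<and> A \<subseteq> V \<and> card A = k" if "k \<le> K" for k
    using that
  proof (induction k)
    case 0
    then show ?case by auto
  next
    case (Suc k)
    then obtain A where A: "\<forall>i<n. ?S k i = A" "A \<subseteq> V" "card A = k"
      by auto
    then have "A \<subset> V" using Suc.prems assms(11) by auto
    then obtain v where v: "v \<in> V - A" "\<forall>i<n. ?S (Suc k) i = {v} \<union> A"
      using step[OF A(1)] by blast
    moreover have "finite A" using A(2) V finite_subset by blast
    ultimately show ?case
      using A by (intro exI[of _ "{v} \<union> A"]) (simp del: dga.simps)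
  qed
  \<comment> \<open>Agent 0 stands for all agents, as their sets coincide in every round.\<close>
  define gap where "gap k = favg Sopt - favg (?S k 0)" for k
  have "gap (Suc k) \<le> (1 - \<gamma>\<^sub>c / real K) * gap k + (\<psi> + 2 * \<epsilon>)" if k: "k < K" for k
  proof -
    obtain A where A: "\<forall>i<n. ?S k i = A" "A \<subseteq> V" "card A = k"
      using consensus[of k] k by auto
    then have "A \<subset> V" using k assms(11) by auto
    then obtain v where v: "\<forall>i<n. ?S (Suc k) i = {v} \<union> A"
      "favg Sopt - favg ({v} \<union> A) \<le> (1 - \<gamma>\<^sub>c / real K) * (favg Sopt - favg A) + (\<psi> + 2 * \<epsilon>)"
      using step[OF A(1)] by blast
    have "?S k 0 = A" "?S (Suc k) 0 = {v} \<union> A"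
      using A(1) v(1) n by (simp_all del: dga.simps)
    then show ?thesis
      unfolding gap_def using v(2) by (simp only:)
  qed
  then have "gap K \<le> (1 - \<gamma>\<^sub>c / real K) ^ K * gap 0 + real K * (\<psi> + 2 * \<epsilon>)"
    using \<gamma> assms(10) \<delta>0 by (intro approximate_contraction_iterate) auto
  moreover have "gap 0 = favg Sopt"
    using assms(6) by (simp add: gap_def favg)
  moreover have "(1 - \<gamma>\<^sub>c / real K) ^ K * favg Sopt \<le> exp (- \<gamma>\<^sub>c) * favg Sopt"
  proof (rule mult_right_mono)
    show "(1 - \<gamma>\<^sub>c / real K) ^ K \<le> exp (- \<gamma>\<^sub>c)"
      using \<gamma> assms(10) by (intro power_one_minus_le_exp) auto
    show "0 \<le> favg Sopt"
      unfolding favg using nonneg[OF _ opt(1)] by (intro mult_nonneg_nonneg sum_nonneg) auto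
  qed
  ultimately have "(1 - exp (- \<gamma>\<^sub>c)) * favg Sopt - real K * (\<psi> + 2 * \<epsilon>) \<le> favg (?S K 0)"
    by (simp add: gap_def left_diff_distrib)
  moreover obtain A where A: "\<forall>i<n. ?S K i = A" "A \<subseteq> V" "card A = K"
    using consensus[OF order_refl] by blast
  moreover have "?S K 0 = A" using A(1) n by simp
  ultimately show ?thesis by simp
qed

end
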